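(* Let $G$ be a tree (possibly infinite) with an ordered bipartition $(V,W)$ of its vertex set. Then $M_T(G)$ is a matroid (and hence a transversal matroid); that is, the subsets of $V$ that are matchable to $W$ in $G$ are the independent sets of a matroid on $V$.
   Context: Matroids (possibly infinite, in the sense of Bruhn et al.): for a set $E$ and $\mathcal I\subseteq 2^E$, let $\mathcal I^{\max}$ be the set of inclusion-maximal elements of $\mathcal I$. The pair $(E,\mathcal I)$ is a matroid if: (I1) $\emptyset\in\mathcal I$; (I2) if $I\subseteq I'$ and $I'\in\mathcal I$ then $I\in\mathcal I$; (I3) for all $I\in\mathcal I\setminus\mathcal I^{\max}$ and $I'\in\mathcal I^{\max}$ there is $x\in I'\setminus I$ with $I\cup\{x\}\in\mathcal I$; (IM) whenever $I\in\mathcal I$ and $I\subseteq X\subseteq E$, the set $\{I'\in\mathcal I: I\subseteq I'\subseteq X\}$ has a maximal element. For a bipartite graph $G$ with an ordered bipartition $(V,W)$ of $V(G)$, a subset $I$ of $V$ is independent if it is matchable to $W$, i.e. there is a matching of $G$ (a set of pairwise disjoint edges) whose set of endvertices in $V$ is $I$. $M_T(G)$ is the pair consisting of $V$ and the collection of independent subsets of $V$. If $M_T(G)$ is a matroid, it is called a transversal matroid. *)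

theory Defs
  imports Main "HOL-Library.Disjoint_Sets"
begin

section \<open>Infinite matroids\<close>

definition max_members :: "'a set set \<Rightarrow> 'a set set" where
  "max_members \<I> = {A \<in> \<I>. \<forall>B\<in>\<I>. A \<subseteq> B \<longrightarrow> B = A}"

text \<open>The independence axioms of Bruhn, Diestel, Kriesell, Pendavingh and Wollan;
  the ground set may be infinite.\<close>

fun is_matroid :: "'a set \<times> 'a set set \<Rightarrow> bool" where
  "is_matroid (E, \<I>) \<longleftrightarrow>
     \<I> \<subseteq> Pow E
     \<and> {} \<in> \<I>
     \<and> (\<forall>I I'. I \<subseteq> I' \<and> I' \<in> \<I> \<longrightarrow> I \<in> \<I>)
     \<and> (\<forall>I \<in> \<I> - max_members \<I>. \<forall>I' \<in> max_members \<I>. \<exists>x \<in> I' - I. I \<union> {x} \<in> \<I>)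
     \<and> (\<forall>I X. I \<in> \<I> \<and> I \<subseteq> X \<and> X \<subseteq> E \<longrightarrow>
          max_members {I' \<in> \<I>. I \<subseteq> I' \<and> I' \<subseteq> X} \<noteq> {})"

section \<open>Simple undirected graphs, possibly infinite\<close>

record 'v sgraph =
  vertices :: "'v set"
  edges :: "'v set set"

definition simple_graph :: "'v sgraph \<Rightarrow> bool" where
  "simple_graph G \<longleftrightarrow> (\<forall>e \<in> edges G. e \<subseteq> vertices G \<and> card e = 2)"

definition walk :: "'v sgraph \<Rightarrow> 'v list \<Rightarrow> bool" where
  "walk G p \<longleftrightarrow>
     p \<noteq> [] \<and> set p \<subseteq> vertices G \<and> successively (\<lambda>u v. {u, v} \<in> edges G) p"

definition connected_graph :: "'v sgraph \<Rightarrow> bool" where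
  "connected_graph G \<longleftrightarrow>
     vertices G \<noteq> {}
     \<and> (\<forall>u \<in> vertices G. \<forall>v \<in> vertices G. \<exists>p. walk G p \<and> hd p = u \<and> last p = v)"

text \<open>A cycle is given by the list of its vertices, without repeating the first one at the end.
  The length bound excludes traversing a single edge back and forth.\<close>

definition cycle :: "'v sgraph \<Rightarrow> 'v list \<Rightarrow> bool" where
  "cycle G p \<longleftrightarrow>
     walk G p \<and> distinct p \<and> length p \<ge> 3 \<and> {last p, hd p} \<in> edges G"

definition tree :: "'v sgraph \<Rightarrow> bool" where
  "tree G \<longleftrightarrow> simple_graph G \<and> connected_graph G \<and> (\<nexists>p. cycle G p)"

definition bipartition :: "'v sgraph \<Rightarrow> 'v set \<Rightarrow> 'v set \<Rightarrow> bool" where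
  "bipartition G V W \<longleftrightarrow>
     V \<union> W = vertices G \<and> V \<inter> W = {} \<and> (\<forall>e \<in> edges G. \<exists>v \<in> V. \<exists>w \<in> W. e = {v, w})"

section \<open>Transversal independence\<close>

definition matching :: "'v sgraph \<Rightarrow> 'v set set \<Rightarrow> bool" where
  "matching G M \<longleftrightarrow> M \<subseteq> edges G \<and> disjoint M"

text \<open>For a bipartition \<open>(V, W)\<close> of \<open>G\<close>, every edge meeting \<open>I \<subseteq> V\<close> has its other end in \<open>W\<close>,
  so \<open>W\<close> need not be an argument.\<close>

definition matchable :: "'v sgraph \<Rightarrow> 'v set \<Rightarrow> 'v set \<Rightarrow> bool" where
  "matchable G V I \<longleftrightarrow> (\<exists>M. matching G M \<and> \<Union>M \<inter> V = I)"

definition M_T :: "'v sgraph \<Rightarrow> 'v set \<Rightarrow> 'v set \<times> 'v set set" where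
  "M_T G V = (V, {I. I \<subseteq> V \<and> matchable G V I})"

end

theory Submission
  imports Defs
begin

text \<open>Root the tree. A vertex of \<open>V\<close> with a child can be matched downwards, and such choices never
  collide; the only vertices that compete are those \<open>v\<close> all of whose children are claimed from
  below. This leads to a maximal well-founded partial choice \<open>c\<close>, assigning to a vertex \<open>w \<in> W\<close> one
  of its children all of whose children lie in the domain of \<open>c\<close>. Vertices of \<open>V\<close> that have a child
  outside the domain of \<open>c\<close> are matched to such a child, and \<open>w\<close> in the domain is matched to \<open>c w\<close>.
  If an independent set \<open>I\<close> has to be covered, then \<open>c\<close> is chosen to extend a maximal choice
  \<open>c0\<close> with values in \<open>I\<close>, and the vertices of \<open>I\<close> missed so far are inserted by pushing
  along paths that descend in the tree. These paths are finite since \<open>c\<close> is well-founded, and the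
  result is maximal since an alternating path from an unmatched vertex would have to climb for a
  while and then descend along \<open>c\<close> forever. The exchange axiom (I3) needs no tree: it holds in all
  bipartite graphs, by alternating paths.\<close>

section \<open>Matchings as injective functions\<close>

text \<open>A system of distinct representatives for an arbitrary relation; for vertices of
  \<open>V\<close> and the edges of a bipartite graph, the partners lie in \<open>W\<close>
  automatically.\<close>

definition inj_matchable :: "('v \<Rightarrow> 'v \<Rightarrow> bool) \<Rightarrow> 'v set \<Rightarrow> bool" where
  "inj_matchable A I \<longleftrightarrow> (\<exists>f. inj_on f I \<and> (\<forall>v\<in>I. A v (f v)))"

lemma inj_matchable_subset:
  assumes "inj_matchable A J" and "I \<subseteq> J"
  shows "inj_matchable A I"
  using assms unfolding inj_matchable_def by (meson inj_on_subset subsetD)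

lemma matchable_iff_inj_matchable:
  assumes bip: "bipartition G V W" and "I \<subseteq> V"
  shows "matchable G V I \<longleftrightarrow> inj_matchable (\<lambda>v w. {v, w} \<in> edges G) I"
proof
  assume "matchable G V I"
  then obtain M where ME: "M \<subseteq> edges G" and dM: "disjoint M" and MI: "\<Union>M \<inter> V = I"
    unfolding matchable_def matching_def by blast
  have "\<exists>w. w \<in> W \<and> {v, w} \<in> M" if vI: "v \<in> I" for v
  proof -
    obtain e where e: "e \<in> M" "v \<in> e" using vI MI by blast
    then have "\<exists>a\<in>V. \<exists>b\<in>W. e = {a, b}"
      using ME bip unfolding bipartition_def by (simp add: subset_iff)
    then obtain a b where "a \<in> V" "b \<in> W" "e = {a, b}" by (elim bexE)
    moreover have "v \<in> V" using vI \<open>I \<subseteq> V\<close> by blast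
    ultimately show ?thesis using e bip unfolding bipartition_def by blast
  qed
  then obtain f where f: "\<And>v. v \<in> I \<Longrightarrow> f v \<in> W \<and> {v, f v} \<in> M" by metis
  have "inj_on f I"
  proof (rule inj_onI)
    fix u v assume uv: "u \<in> I" "v \<in> I" "f u = f v"
    then have "{u, f u} \<in> M" "{v, f u} \<in> M" using f[of u] f[of v] by auto
    then have "{u, f u} = {v, f u}" using disjointD[OF dM, of "{u, f u}" "{v, f u}"] by blast
    moreover have "u \<noteq> f u"
      using f[of u] uv(1) \<open>I \<subseteq> V\<close> bip unfolding bipartition_def by auto
    ultimately show "u = v" by (auto simp: doubleton_eq_iff)
  qed
  then show "inj_matchable (\<lambda>v w. {v, w} \<in> edges G) I"
    unfolding inj_matchable_def using f ME by blast
next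
  assume "inj_matchable (\<lambda>v w. {v, w} \<in> edges G) I"
  then obtain f where inj: "inj_on f I" and f: "\<And>v. v \<in> I \<Longrightarrow> {v, f v} \<in> edges G"
    unfolding inj_matchable_def by blast
  have fW: "f v \<in> W" "f v \<notin> V" if vI: "v \<in> I" for v
  proof -
    have "\<exists>a\<in>V. \<exists>b\<in>W. {v, f v} = {a, b}"
      using bip f[OF vI] unfolding bipartition_def by simp
    then obtain a b where "a \<in> V" "b \<in> W" "{v, f v} = {a, b}" by (elim bexE)
    moreover have "v \<in> V" using vI \<open>I \<subseteq> V\<close> by blast
    ultimately show "f v \<in> W" "f v \<notin> V"
      using bip unfolding bipartition_def by (auto simp: doubleton_eq_iff)
  qed
  let ?M = "(\<lambda>v. {v, f v}) ` I"
  have "disjoint ?M"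
    unfolding disjoint_def using fW inj \<open>I \<subseteq> V\<close> by (auto simp: inj_on_def)
  moreover have "\<Union>?M \<inter> V = I" using fW \<open>I \<subseteq> V\<close> by auto
  moreover have "?M \<subseteq> edges G" using f by (simp add: image_subset_iff)
  ultimately show "matchable G V I"
    unfolding matchable_def matching_def by (intro exI[of _ ?M] conjI)
qed

section \<open>The exchange axiom\<close>

text \<open>Alternating path argument: the path from \<open>y\<close> must leave
  \<open>insert y I\<close>, since switching along it would otherwise add \<open>y\<close> to
  \<open>I'\<close>; switching only up to an exit vertex \<open>x\<close> trades \<open>y\<close>
  for \<open>x\<close>.\<close>

lemma inj_matchable_exchange:
  assumes "inj_matchable A (insert y I)" and "y \<notin> I"
    and "inj_matchable A I'" and max: "y \<notin> I' \<Longrightarrow> \<not> inj_matchable A (insert y I')"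
  shows "\<exists>x\<in>I' - I. inj_matchable A (insert x I)"
proof (cases "y \<in> I'")
  case True
  then show ?thesis using assms by blast
next
  case False
  obtain m where m: "inj_on m (insert y I)" "\<And>v. v \<in> insert y I \<Longrightarrow> A v (m v)"
    using assms(1) unfolding inj_matchable_def by blast
  obtain n where n: "inj_on n I'" "\<And>v. v \<in> I' \<Longrightarrow> A v (n v)"
    using assms(3) unfolding inj_matchable_def by blast
  \<comment> \<open>A step follows the \<open>m\<close>-edge of \<open>u\<close> and then returns
    along the \<open>n\<close>-edge at the same partner; \<open>R\<close> is the alternating path
    starting at \<open>y\<close>.\<close>
  define S where "S = {(u, v). u \<in> insert y I \<and> v \<in> I' \<and> n v = m u}"
  define R where "R = S\<^sup>* `` {y}"
  have RI': "R \<subseteq> insert y I'"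
    unfolding R_def S_def by (auto elim: rtranclE)
  have closed: "v \<in> R" if "u \<in> R" "(u, v) \<in> S" for u v
    using that unfolding R_def by (auto intro: rtrancl_into_rtrancl)
  have "\<not> R \<subseteq> insert y I"
  proof
    assume RI: "R \<subseteq> insert y I"
    define h where "h v = (if v \<in> R then m v else n v)" for v
    have yR: "y \<in> R" unfolding R_def by simp
    have cross: "m u \<noteq> n v" if "u \<in> R" "v \<in> I'" "v \<notin> R" for u v
      using closed[OF that(1)] that RI unfolding S_def by auto
    have "inj_on h (insert y I')"
    proof (rule inj_onI)
      fix u v assume uv: "u \<in> insert y I'" "v \<in> insert y I'" "h u = h v"
      consider "u \<in> R" "v \<in> R" | "u \<notin> R" "v \<notin> R" | "u \<in> R" "v \<notin> R" | "u \<notin> R" "v \<in> R"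
        by blast
      then show "u = v"
      proof cases
        case 1 then show ?thesis using uv m(1) RI unfolding h_def inj_on_def by auto
      next
        case 2 then show ?thesis using uv n(1) yR unfolding h_def inj_on_def by auto
      next
        case 3 then show ?thesis using uv cross[of u v] yR unfolding h_def by auto
      next
        case 4 then show ?thesis using uv cross[of v u] yR unfolding h_def by auto
      qed
    qed
    moreover have "A v (h v)" if "v \<in> insert y I'" for v
      using that m(2) n(2) RI yR unfolding h_def by auto
    ultimately show False using max False unfolding inj_matchable_def by blast
  qed
  then obtain x where x: "x \<in> R" "x \<notin> insert y I" by blast
  \<comment> \<open>The portion of the path leading to \<open>x\<close>. Switching \<open>m\<close>
    to \<open>n\<close> there covers \<open>x\<close>, at the cost of \<open>y\<close>.\<close>
  define C where "C = (S\<inverse>)\<^sup>* `` {x}"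
  \<comment> \<open>Injectivity of \<open>m\<close> makes backward steps unique, so walking back
    from \<open>x\<close> stays on the path from \<open>y\<close>; \<open>noSy\<close> ends the walk
    at \<open>y\<close>.\<close>
  have SR: "u \<in> R" if "v \<in> R" "v \<noteq> y" "(u, v) \<in> S" for u v
  proof -
    from that(1,2) obtain u' where u': "u' \<in> R" "(u', v) \<in> S"
      unfolding R_def by (auto elim: rtranclE)
    then have "u' = u" using that(3) m(1) unfolding S_def inj_on_def by auto
    then show ?thesis using u' by simp
  qed
  have noSy: "(u, y) \<notin> S" for u using False unfolding S_def by auto
  have CR: "C \<subseteq> R"
  proof
    fix v assume "v \<in> C"
    then have "(x, v) \<in> (S\<inverse>)\<^sup>*" unfolding C_def by simp
    then show "v \<in> R"
    proof induction
      case base then show ?case using x by simp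
    next
      case (step u v) then show ?case using SR noSy by blast
    qed
  qed
  have Cclosed: "u \<in> C" if "v \<in> C" "(u, v) \<in> S" for u v
    using that unfolding C_def by (auto intro: rtrancl_into_rtrancl)
  have xC: "x \<in> C" unfolding C_def by simp
  have yJ: "y \<notin> insert x I" using x assms(2) by auto
  define h where "h v = (if v \<in> C then n v else m v)" for v
  have CI': "v \<in> I'" if "v \<in> insert x I" "v \<in> C" for v
    using that CR RI' yJ by blast
  have cross: "n v \<noteq> m u" if "v \<in> insert x I" "v \<in> C" "u \<in> I" "u \<notin> C" for u v
    using Cclosed[OF that(2), of u] CI'[OF that(1,2)] that unfolding S_def by auto
  have "inj_on h (insert x I)"
  proof (rule inj_onI)
    fix u v assume uv: "u \<in> insert x I" "v \<in> insert x I" "h u = h v"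
    consider "u \<in> C" "v \<in> C" | "u \<notin> C" "v \<notin> C" | "u \<in> C" "v \<notin> C" | "u \<notin> C" "v \<in> C"
      by blast
    then show "u = v"
    proof cases
      case 1 then show ?thesis
        using uv n(1) CI'[of u] CI'[of v] unfolding h_def inj_on_def by auto
    next
      case 2 then show ?thesis using uv m(1) xC unfolding h_def inj_on_def by auto
    next
      case 3 then show ?thesis using uv cross[of u v] xC unfolding h_def by auto
    next
      case 4 then show ?thesis using uv cross[of v u] xC unfolding h_def by auto
    qed
  qed
  moreover have "A v (h v)" if "v \<in> insert x I" for v
    using that m(2) n(2) CI' xC unfolding h_def by auto
  ultimately have "inj_matchable A (insert x I)" unfolding inj_matchable_def by blast
  moreover have "x \<in> I' - I" using x RI' by blast
  ultimately show ?thesis by blast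
qed

section \<open>Rooted forests\<close>

text \<open>\<open>P p x\<close> means that \<open>p\<close> is the parent of \<open>x\<close>.\<close>

locale rooted_forest =
  fixes P :: "'v \<Rightarrow> 'v \<Rightarrow> bool"
  assumes parent_unique: "P p x \<Longrightarrow> P q x \<Longrightarrow> p = q"
    and wf_parent: "wf {(p, x). P p x}"
begin

definition adj :: "'v \<Rightarrow> 'v \<Rightarrow> bool" where
  "adj u v \<longleftrightarrow> P u v \<or> P v u"

section \<open>Well-founded partial choices\<close>

definition descent :: "('v \<times> 'v) set \<Rightarrow> ('v \<times> 'v) set" where
  "descent c = {(v', v). \<exists>w. P v w \<and> (w, v') \<in> c}"

text \<open>Partial functions are sets of pairs so that Zorn's lemma applies to inclusion. The
  accessibility clause forbids values that support one another along an infinite descending path,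
  and later inductions run on it.\<close>

definition choice :: "'v set \<Rightarrow> ('v \<times> 'v) set \<Rightarrow> bool" where
  "choice Y c \<longleftrightarrow> single_valued c \<and>
     (\<forall>(w, v) \<in> c. v \<in> Y \<and> P w v \<and> Collect (P v) \<subseteq> Domain c \<and> v \<in> Wellfounded.acc (descent c))"

lemma choiceD:
  assumes "choice Y c" and "(w, v) \<in> c"
  shows "v \<in> Y" "P w v" "P v x \<Longrightarrow> x \<in> Domain c" "v \<in> Wellfounded.acc (descent c)"
  using assms unfolding choice_def by blast+

lemma choice_unique: "choice Y c \<Longrightarrow> (w, u) \<in> c \<Longrightarrow> (w, v) \<in> c \<Longrightarrow> u = v"
  unfolding choice_def single_valued_def by blast

text \<open>Every descent lands on a value of \<open>c\<close>, which is accessible by definition,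
  so accessibility extends to all vertices.\<close>

lemma choice_acc: "choice Y c \<Longrightarrow> v \<in> Wellfounded.acc (descent c)"
  by (rule accI) (auto simp: descent_def dest: choiceD(4))

text \<open>Enlarging a choice does not change its descents, since the children of a chosen vertex
  already lie in the domain.\<close>

lemma acc_descent_superset:
  assumes c: "choice Y c" and "c \<subseteq> c'" and "single_valued c'"
    and v: "Collect (P v) \<subseteq> Domain c"
  shows "v \<in> Wellfounded.acc (descent c')"
  using choice_acc[OF c, of v] v
proof (induction rule: acc.induct)
  case (accI v)
  show ?case
  proof (rule Wellfounded.acc.accI)
    fix u assume "(u, v) \<in> descent c'"
    then obtain w where w: "P v w" "(w, u) \<in> c'" unfolding descent_def by blast
    then obtain u' where u': "(w, u') \<in> c" using accI.prems by blast
    then have "u' = u" using w assms(2,3) unfolding single_valued_def by blast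
    then have "(w, u) \<in> c" using u' by simp
    moreover from this w have "(u, v) \<in> descent c" unfolding descent_def by blast
    ultimately show "u \<in> Wellfounded.acc (descent c')"
      using accI.IH choiceD(3)[OF c] by blast
  qed
qed

text \<open>Zorn's lemma; the closure property holds because a pair violating it could be added to
  \<open>c\<close>.\<close>

lemma maximal_choice:
  assumes c0: "choice Y c0"
  obtains c where "choice Y c" "c0 \<subseteq> c"
    "\<And>w v. v \<in> Y \<Longrightarrow> P w v \<Longrightarrow> Collect (P v) \<subseteq> Domain c \<Longrightarrow> w \<in> Domain c"
proof -
  let ?A = "{c. choice Y c \<and> c0 \<subseteq> c}"
  have "\<exists>M\<in>?A. \<forall>X\<in>?A. M \<subseteq> X \<longrightarrow> X = M"
  proof (rule subset_Zorn_nonempty)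
    show "?A \<noteq> {}" using c0 by blast
  next
    fix C assume "C \<noteq> {}" and "subset.chain ?A C"
    then have C: "\<And>c. c \<in> C \<Longrightarrow> choice Y c \<and> c0 \<subseteq> c"
      and chain: "\<And>a b. a \<in> C \<Longrightarrow> b \<in> C \<Longrightarrow> a \<subseteq> b \<or> b \<subseteq> a"
      unfolding subset_chain_def by blast+
    have sv: "single_valued (\<Union>C)"
    proof (rule single_valuedI)
      fix w u v assume "(w, u) \<in> \<Union>C" "(w, v) \<in> \<Union>C"
      then obtain a b where "a \<in> C" "b \<in> C" "(w, u) \<in> a" "(w, v) \<in> b" by blast
      then show "u = v" using chain[of a b] C choice_unique by blast
    qed
    have "v \<in> Y \<and> P w v \<and> Collect (P v) \<subseteq> Domain (\<Union>C) \<and> v \<in> Wellfounded.acc (descent (\<Union>C))"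
      if wv: "(w, v) \<in> \<Union>C" for w v
    proof -
      obtain a where a: "a \<in> C" "(w, v) \<in> a" using wv by blast
      then have "choice Y a" using C by blast
      note D = choiceD[OF this a(2)]
      have "v \<in> Wellfounded.acc (descent (\<Union>C))"
        by (rule acc_descent_superset[OF \<open>choice Y a\<close> _ sv]) (use a D in auto)
      then show ?thesis using D a(1) by blast
    qed
    then show "\<Union>C \<in> ?A" using sv C \<open>C \<noteq> {}\<close> unfolding choice_def by blast
  qed
  then obtain c where "c \<in> ?A" and max_A: "\<forall>X\<in>?A. c \<subseteq> X \<longrightarrow> X = c" by blast
  then have c: "choice Y c" "c0 \<subseteq> c" by simp_all
  have max: "c' = c" if "choice Y c'" "c \<subseteq> c'" for c'
    using max_A that c(2) by blast
  have "w \<in> Domain c" if v: "v \<in> Y" "P w v" "Collect (P v) \<subseteq> Domain c" for w v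
  proof (rule ccontr)
    assume nw: "w \<notin> Domain c"
    let ?c = "insert (w, v) c"
    have sv: "single_valued ?c"
      using c(1) nw unfolding choice_def single_valued_def by blast
    have "v \<in> Wellfounded.acc (descent ?c)"
      by (rule acc_descent_superset[OF c(1) _ sv v(3)]) blast
    moreover have "u \<in> Wellfounded.acc (descent ?c)" if "(x, u) \<in> c" for x u
      by (rule acc_descent_superset[OF c(1) _ sv]) (use that choiceD(3)[OF c(1)] in blast)+
    ultimately have "choice Y ?c"
      using sv v c(1) unfolding choice_def by auto
    then show False using max[of ?c] nw by blast
  qed
  then show thesis using that c by blast
qed

text \<open>If \<open>m v\<close> were a child of \<open>v\<close>, then the vertex \<open>u\<close>
  chosen at \<open>m v\<close> would by induction also be matched to its parent \<open>m v\<close>,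
  so \<open>u = v\<close>, absurd in a forest.\<close>

lemma choice_forced:
  assumes c: "choice I c"
    and inj: "inj_on m I" and m: "\<And>v. v \<in> I \<Longrightarrow> adj v (m v)"
    and v: "v \<in> I" "Collect (P v) \<subseteq> Domain c"
  shows "P (m v) v"
  using choice_acc[OF c, of v] v
proof (induction rule: acc.induct)
  case (accI v)
  show ?case
  proof (rule ccontr)
    assume "\<not> P (m v) v"
    then have vw: "P v (m v)" using m[OF accI.prems(1)] unfolding adj_def by blast
    then obtain u where u: "(m v, u) \<in> c" using accI.prems by blast
    note D = choiceD[OF c u]
    have "(u, v) \<in> descent c" unfolding descent_def using u vw by blast
    then have "P (m u) u" using accI.IH D by blast
    then have "m u = m v" using D(2) parent_unique by blast
    then have "u = v" using inj D(1) accI.prems(1) unfolding inj_on_def by blast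
    then have "P v (m v)" "P (m v) v" using vw D(2) by auto
    then show False using wf_asym[OF wf_parent, of v "m v"] by blast
  qed
qed

section \<open>Maximal matchable sets in a forest\<close>

lemma maximal_inj_matchable:
  assumes I: "inj_matchable adj I" and "I \<subseteq> X"
  obtains B where "I \<subseteq> B" "B \<subseteq> X" "inj_matchable adj B"
    "\<And>x. x \<in> X - B \<Longrightarrow> \<not> inj_matchable adj (insert x B)"
proof -
  obtain m where inj_m: "inj_on m I" and m: "\<And>v. v \<in> I \<Longrightarrow> adj v (m v)"
    using I unfolding inj_matchable_def by blast
  \<comment> \<open>The first choice has values in \<open>I\<close>, so \<open>choice_forced\<close>
    applies to it with the given matching \<open>m\<close>; the second extends it as far as
    \<open>X\<close> permits.\<close>
  have "choice I {}" unfolding choice_def by simp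
  then obtain c0 where c0: "choice I c0"
    and max0: "\<And>w v. v \<in> I \<Longrightarrow> P w v \<Longrightarrow> Collect (P v) \<subseteq> Domain c0 \<Longrightarrow> w \<in> Domain c0"
    by (rule maximal_choice) blast
  have "choice X c0" using c0 \<open>I \<subseteq> X\<close> unfolding choice_def by blast
  then obtain c where c: "choice X c" and "c0 \<subseteq> c"
    and max: "\<And>w v. v \<in> X \<Longrightarrow> P w v \<Longrightarrow> Collect (P v) \<subseteq> Domain c \<Longrightarrow> w \<in> Domain c"
    by (rule maximal_choice) blast
  define Z where "Z = Domain c"
  \<comment> \<open>Vertices of \<open>U\<close> have no child outside \<open>Z\<close> and compete
    for \<open>Z\<close>; the rest of \<open>X\<close> uses \<open>e\<close>. The
    \<open>SOME\<close> terms matter only where a witness exists.\<close>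
  define U where "U = {v \<in> X. Collect (P v) \<subseteq> Z}"
  define d where "d v = (SOME x. P v x \<and> x \<notin> Domain c0)" for v
  define e where "e v = (SOME x. P v x \<and> x \<notin> Z)" for v
  define parent where "parent v = (SOME w. P w v)" for v
  have parent: "parent v = w" if "P w v" for v w
    unfolding parent_def using that parent_unique by blast
  have range_U: "v \<in> U" if "(w, v) \<in> c" for w v
    using choiceD[OF c that] unfolding U_def Z_def by blast
  have e: "P v (e v)" "e v \<notin> Z" if "v \<in> X" "v \<notin> U" for v
  proof -
    have "\<exists>x. P v x \<and> x \<notin> Z" using that unfolding U_def by blast
    from someI_ex[OF this] show "P v (e v)" "e v \<notin> Z" unfolding e_def by blast+
  qed
  have d: "P v (d v)" "d v \<notin> Domain c0" if v: "v \<in> I" "v \<notin> Range c0" for v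
  proof -
    \<comment> \<open>Otherwise \<open>m\<close> matches \<open>v\<close> to its parent, which lies
      in \<open>Domain c0\<close> by maximality; the vertex chosen there is matched to the same
      parent, hence is \<open>v\<close>, which is outside \<open>Range c0\<close>.\<close>
    have "\<not> Collect (P v) \<subseteq> Domain c0"
    proof
      assume *: "Collect (P v) \<subseteq> Domain c0"
      then have mv: "P (m v) v" using choice_forced[OF c0 inj_m m] v(1) by blast
      then obtain u where u: "(m v, u) \<in> c0" using max0[OF v(1) _ *] by blast
      note D = choiceD[OF c0 u]
      have "P (m u) u" using choice_forced[OF c0 inj_m m D(1)] D(3) by blast
      then have "m u = m v" using D(2) parent_unique by blast
      then have "u = v" using inj_m D(1) v(1) unfolding inj_on_def by blast
      then show False using u v(2) by blast
    qed
    then have "\<exists>x. P v x \<and> x \<notin> Domain c0" by blast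
    from someI_ex[OF this] show "P v (d v)" "d v \<notin> Domain c0" unfolding d_def by blast+
  qed

  \<comment> \<open>Giving \<open>d v\<close> to \<open>v\<close> displaces the vertex that
    \<open>c\<close> assigned to \<open>d v\<close>; if it belongs to \<open>I\<close>, it must move
    as well. \<open>K\<close> collects all vertices moved, starting from those of \<open>I\<close>
    in \<open>U\<close> that \<open>c\<close> misses.\<close>
  define S where "S = {(v, v'). v' \<in> I \<and> (d v, v') \<in> c}"
  define K where "K = S\<^sup>* `` ((I \<inter> U) - Range c)"
  have K_start: "v \<in> K" if "v \<in> I" "v \<in> U" "v \<notin> Range c" for v
    using that unfolding K_def by blast
  have K_step: "v' \<in> K" if "v \<in> K" "v' \<in> I" "(d v, v') \<in> c" for v v'
    using that unfolding K_def S_def by (auto intro: rtrancl_into_rtrancl)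
  \<comment> \<open>Since \<open>d\<close> avoids \<open>Domain c0\<close>, no value of
    \<open>c0\<close> is ever displaced, so \<open>d\<close> keeps its defining property along the
    whole path.\<close>
  have K: "v \<in> I \<and> v \<in> U \<and> v \<notin> Range c0" if "v \<in> K" for v
  proof -
    obtain s where s: "s \<in> (I \<inter> U) - Range c" and "(s, v) \<in> S\<^sup>*"
      using \<open>v \<in> K\<close> unfolding K_def by blast
    from this(2) show ?thesis
    proof induction
      case base then show ?case using s \<open>c0 \<subseteq> c\<close> by blast
    next
      case (step u v)
      have uv: "v \<in> I" "(d u, v) \<in> c" using step.hyps unfolding S_def by blast+
      have "v \<notin> Range c0"
      proof
        assume "v \<in> Range c0"
        then obtain w where w: "(w, v) \<in> c0" by blast
        then have "w = d u"
          using choiceD(2)[OF c0 w] choiceD(2)[OF c uv(2)] parent_unique by blast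
        then show False using w d(2)[of u] step.IH by blast
      qed
      then show ?case using uv range_U by blast
    qed
  qed
  have dK: "P v (d v)" "d v \<in> Z" if "v \<in> K" for v
  proof -
    show "P v (d v)" using d K[OF that] by blast
    then show "d v \<in> Z" using K[OF that] unfolding U_def by blast
  qed

  \<comment> \<open>The values of \<open>c\<close> that keep their place; displaced vertices outside
    \<open>I\<close> are dropped.\<close>
  define N where "N = {v. \<exists>w. (w, v) \<in> c \<and> w \<notin> d ` K}"
  define B where "B = (X - U) \<union> K \<union> N"
  define f where "f v = (if v \<notin> U then e v else if v \<in> K then d v else parent v)" for v
  have N: "(parent v, v) \<in> c \<and> parent v \<notin> d ` K \<and> P (parent v) v \<and> v \<in> U" if "v \<in> N" for v
  proof -
    obtain w where w: "(w, v) \<in> c" "w \<notin> d ` K" using \<open>v \<in> N\<close> unfolding N_def by blast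
    then show ?thesis using parent choiceD(2)[OF c w(1)] range_U by auto
  qed
  have NK: "v \<notin> K" if "v \<in> N" for v
  proof
    assume "v \<in> K"
    then obtain s where s: "s \<in> (I \<inter> U) - Range c" "(s, v) \<in> S\<^sup>*" unfolding K_def by blast
    have "s \<noteq> v" using s N[OF that] by blast
    then obtain u where u: "(s, u) \<in> S\<^sup>*" "(u, v) \<in> S" using s(2) by (meson rtranclE)
    then have "u \<in> K" "(d u, v) \<in> c" using s(1) unfolding K_def S_def by blast+
    then show False using N[OF that] choiceD(2)[OF c] parent by blast
  qed
  have f_e: "f v = e v \<and> P v (f v) \<and> f v \<notin> Z" if "v \<in> X - U" for v
    using that e[of v] unfolding f_def by auto
  have f_d: "f v = d v \<and> P v (f v) \<and> f v \<in> Z" if "v \<in> K" for v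
    using that dK K[of v] unfolding f_def by auto
  have f_N: "(f v, v) \<in> c \<and> P (f v) v \<and> f v \<in> Z \<and> f v \<notin> d ` K" if "v \<in> N" for v
    using N[OF that] NK[OF that] unfolding f_def Z_def by auto
  have inj_f: "inj_on f B"
  proof (rule inj_onI)
    fix u v assume uv: "u \<in> B" "v \<in> B" "f u = f v"
    consider "u \<in> N" "v \<in> N" | "u \<in> N" "v \<notin> N" | "u \<notin> N" "v \<in> N" | "u \<notin> N" "v \<notin> N"
      by blast
    then show "u = v"
    proof cases
      case 1 then show ?thesis using f_N[of u] f_N[of v] uv choice_unique[OF c] by metis
    next
      case 2
      then have "v \<in> X - U \<or> v \<in> K" using uv unfolding B_def by blast
      then show ?thesis using f_N[OF 2(1)] f_e[of v] f_d[of v] uv by auto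
    next
      case 3
      then have "u \<in> X - U \<or> u \<in> K" using uv unfolding B_def by blast
      then show ?thesis using f_N[OF 3(2)] f_e[of u] f_d[of u] uv by auto
    next
      case 4
      then have "P u (f u)" "P v (f v)" using uv f_e f_d unfolding B_def by blast+
      then show ?thesis using uv parent_unique by metis
    qed
  qed
  have f_adj: "adj v (f v)" if "v \<in> B" for v
    using that f_e f_d f_N unfolding B_def adj_def by blast
  \<comment> \<open>Displacement changes the user of a vertex of \<open>Z\<close> but never frees
    it, so an alternating path that enters \<open>Z\<close> can always continue.\<close>
  have covers: "\<exists>u \<in> B \<inter> U. f u = w \<and> (P u w \<and> u \<in> K \<or> (w, u) \<in> c \<and> P w u)" if "w \<in> Z" for w
  proof (cases "w \<in> d ` K")
    case True
    then obtain u where "u \<in> K" "w = d u" by blast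
    then show ?thesis using f_d[of u] K[of u] unfolding B_def by auto
  next
    case False
    obtain u where u: "(w, u) \<in> c" using \<open>w \<in> Z\<close> unfolding Z_def by blast
    then have "u \<in> N" using False unfolding N_def by blast
    moreover have "f u = w" using parent_unique f_N[OF \<open>u \<in> N\<close>] choiceD(2)[OF c u] by blast
    ultimately show ?thesis using u f_N[of u] range_U unfolding B_def by blast
  qed

  show thesis
  proof (rule that)
    show "I \<subseteq> B"
    proof
      fix v assume v: "v \<in> I"
      show "v \<in> B"
      proof (cases "v \<in> U \<and> v \<in> Range c")
        case True
        then obtain w where w: "(w, v) \<in> c" by blast
        show ?thesis
        proof (cases "w \<in> d ` K")
          case True
          then have "v \<in> K" using K_step w v by blast
          then show ?thesis unfolding B_def by blast
        next
          case False
          then show ?thesis using w unfolding B_def N_def by blast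
        qed
      next
        case False
        then show ?thesis using K_start v \<open>I \<subseteq> X\<close> unfolding B_def by blast
      qed
    qed
    show "B \<subseteq> X" using K N unfolding B_def U_def by blast
    show "inj_matchable adj B" unfolding inj_matchable_def using inj_f f_adj by blast
  next
    fix x assume x: "x \<in> X - B"
    show "\<not> inj_matchable adj (insert x B)"
    proof
      assume "inj_matchable adj (insert x B)"
      then obtain g where inj_g: "inj_on g (insert x B)"
        and g: "\<And>v. v \<in> insert x B \<Longrightarrow> adj v (g v)"
        unfolding inj_matchable_def by blast
      have xU: "x \<in> U" using x unfolding B_def by blast
      \<comment> \<open>The vertices of \<open>U\<close> from which an alternating path can go on:
        \<open>x\<close>, and those where \<open>f\<close> and \<open>g\<close> disagree.\<close>
      define Q where "Q y \<longleftrightarrow> y \<in> insert x B \<and> y \<in> U \<and> (y \<in> B \<longrightarrow> f y \<noteq> g y)" for y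
      \<comment> \<open>If \<open>g y\<close> is a child, this is \<open>y \<in> U\<close>; if it is
        the parent, it is maximality of \<open>c\<close>.\<close>
      have gZ: "g y \<in> Z" if "Q y" for y
        using that g[of y] max[of y] unfolding Q_def U_def adj_def Z_def by blast
      \<comment> \<open>The vertex \<open>u\<close> using \<open>g y\<close> under \<open>f\<close>
        is not \<open>y\<close>, so injectivity of \<open>g\<close> sends \<open>u\<close> elsewhere
        and the path continues from \<open>u\<close>.\<close>
      have next_Q: "\<exists>u. Q u \<and> f u = g y \<and> g u \<noteq> g y \<and> u \<noteq> y \<and>
          (P u (g y) \<and> u \<in> K \<or> (g y, u) \<in> c \<and> P (g y) u)" if "Q y" for y
      proof -
        obtain u where u: "u \<in> B \<inter> U" "f u = g y"
          "P u (g y) \<and> u \<in> K \<or> (g y, u) \<in> c \<and> P (g y) u"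
          using covers[OF gZ[OF \<open>Q y\<close>]] by blast
        have "u \<noteq> y" using u \<open>Q y\<close> unfolding Q_def by blast
        moreover have "g u \<noteq> g y"
          using inj_onD[OF inj_g, of u y] u(1) \<open>u \<noteq> y\<close> \<open>Q y\<close> unfolding Q_def by blast
        moreover from this have "Q u" using u(1,2) unfolding Q_def by auto
        ultimately show ?thesis using u(2,3) by blast
      qed
      have child: "P u (g u)" if "Q u" "P w u" "g u \<noteq> w" for u w
        using g[of u] that parent_unique[of "g u" u w] unfolding Q_def adj_def by blast
      \<comment> \<open>After a step down to a child, the next vertex is the one chosen by
        \<open>c\<close> there; its parent is taken by \<open>y\<close>, so it goes down again. This
        would descend forever along \<open>c\<close>.\<close>
      have down: False if "Q y" "P y (g y)" for y
        using choice_acc[OF c, of y] that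
      proof (induction rule: acc.induct)
        case (accI y)
        obtain u where u: "Q u" "g u \<noteq> g y" "u \<noteq> y"
          "P u (g y) \<or> (g y, u) \<in> c \<and> P (g y) u"
          using next_Q[OF accI.prems(1)] by blast
        have "\<not> P u (g y)" using parent_unique[OF accI.prems(2), of u] u(3) by blast
        then have uc: "(g y, u) \<in> c" "P (g y) u" using u(4) by blast+
        have "(u, y) \<in> descent c" unfolding descent_def using uc accI.prems(2) by blast
        moreover have "P u (g u)" using child[OF u(1) uc(2) u(2)] .
        ultimately show ?case using accI.IH u(1) by blast
      qed
      \<comment> \<open>With descending steps excluded, \<open>g y\<close> is the parent of
        \<open>y\<close>, and the next vertex is the grandparent or a sibling. A sibling would have
        to go down; the grandparent is two levels up, hence the transitive closure.\<close>
      have "\<not> Q y" for y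
      proof (induction y rule: wf_induct_rule[OF wf_trancl[OF wf_parent]])
        case (1 y)
        show ?case
        proof
          assume y: "Q y"
          have up: "P (g y) y" using g[of y] down[OF y] y unfolding Q_def adj_def by blast
          obtain u where u: "Q u" "g u \<noteq> g y" "u \<noteq> y" "P u (g y) \<or> P (g y) u"
            using next_Q[OF y] by blast
          from u(4) show False
          proof
            assume "P u (g y)"
            then have "(u, y) \<in> {(p, x). P p x}\<^sup>+" 
              using up by (intro trancl_into_trancl[OF r_into_trancl, of u "g y"]) simp_all
            then show False using 1 u(1) by blast
          next
            assume "P (g y) u"
            then have "P u (g u)" using child[OF u(1) _ u(2)] by blast
            then show False using down u(1) by blast
          qed
        qed
      qed
      moreover have "Q x" using x xU unfolding Q_def by blast
      ultimately show False by blast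
    qed
  qed
qed

end

section \<open>Rooting a tree\<close>

text \<open>Prepend vertices one at a time; if a new vertex already occurs, cut the path back to
  that occurrence.\<close>

lemma rtrancl_imp_distinct_path:
  assumes "(a, b) \<in> R\<^sup>*" and "a \<in> S" and "R \<subseteq> S \<times> S"
  obtains p where "p \<noteq> []" "hd p = a" "last p = b" "distinct p" "set p \<subseteq> S"
    "successively (\<lambda>u v. (u, v) \<in> R) p"
proof -
  have "\<exists>p. p \<noteq> [] \<and> hd p = a \<and> last p = b \<and> distinct p \<and> set p \<subseteq> S \<and>
      successively (\<lambda>u v. (u, v) \<in> R) p"
    using assms(1,2)
  proof (induction rule: converse_rtrancl_induct)
    case base
    then show ?case by (intro exI[of _ "[b]"]) auto
  next
    case (step a a')
    then obtain p where p: "p \<noteq> []" "hd p = a'" "last p = b" "distinct p" "set p \<subseteq> S"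
      "successively (\<lambda>u v. (u, v) \<in> R) p" using assms(3) by blast
    show ?case
    proof (cases "a \<in> set p")
      case True
      then obtain q r where "p = q @ a # r" by (meson split_list)
      then show ?thesis
        using p by (intro exI[of _ "a # r"]) (auto simp: successively_append_iff)
    next
      case False
      then show ?thesis
        using p step.hyps step.prems
        by (intro exI[of _ "a # p"]) (auto simp: successively_Cons)
    qed
  qed
  then show thesis using that by blast
qed

lemma walk_imp_rtrancl:
  assumes "walk G p"
  shows "(hd p, last p) \<in> {(u, v). {u, v} \<in> edges G}\<^sup>*"
proof -
  have "successively (\<lambda>u v. {u, v} \<in> edges G) p \<Longrightarrow> p \<noteq> [] \<Longrightarrow>
      (hd p, last p) \<in> {(u, v). {u, v} \<in> edges G}\<^sup>*"
    by (induction p rule: induct_list012) (auto intro: converse_rtrancl_into_rtrancl)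
  then show ?thesis using assms unfolding walk_def by blast
qed

section \<open>Distance layers around a root\<close>

locale rooted_tree =
  fixes G :: "'v sgraph" and V W :: "'v set" and r :: 'v
  assumes tree: "tree G" and bip: "bipartition G V W" and root: "r \<in> vertices G"
begin

definition E :: "('v \<times> 'v) set" where
  "E = {(u, v). {u, v} \<in> edges G}"

definition depth :: "'v \<Rightarrow> nat" where
  "depth v = (LEAST n. (r, v) \<in> E ^^ n)"

definition is_parent :: "'v \<Rightarrow> 'v \<Rightarrow> bool" where
  "is_parent p x \<longleftrightarrow> (p, x) \<in> E \<and> depth x = Suc (depth p)"

lemma E_sym: "(u, v) \<in> E \<Longrightarrow> (v, u) \<in> E"
  unfolding E_def by (simp add: insert_commute)

lemma E_vertices: "(u, v) \<in> E \<Longrightarrow> u \<in> vertices G \<and> v \<in> vertices G"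
  using tree unfolding E_def tree_def simple_graph_def by blast

lemma E_sides: "(u, v) \<in> E \<Longrightarrow> u \<in> V \<and> v \<in> W \<or> u \<in> W \<and> v \<in> V"
  using bip unfolding E_def bipartition_def by (blast dest: doubleton_eq_iff[THEN iffD1])

lemma disjoint_VW: "V \<inter> W = {}"
  using bip unfolding bipartition_def by blast

lemma depth_path:
  assumes "v \<in> vertices G"
  shows "(r, v) \<in> E ^^ depth v"
proof -
  obtain p where "walk G p" "hd p = r" "last p = v"
    using tree root assms unfolding tree_def connected_graph_def by blast
  then have "(r, v) \<in> E\<^sup>*" using walk_imp_rtrancl unfolding E_def by metis
  then show ?thesis unfolding depth_def by (meson LeastI rtrancl_imp_relpow)
qed

lemma depth_le: "(r, v) \<in> E ^^ n \<Longrightarrow> depth v \<le> n"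
  unfolding depth_def by (rule Least_le)

text \<open>Every edge changes sides; this will exclude edges within one distance layer.\<close>

lemma parity:
  assumes "(r, v) \<in> E ^^ n"
  shows "v \<in> V \<longleftrightarrow> (r \<in> V \<longleftrightarrow> even n)"
  using assms
proof (induction n arbitrary: v)
  case 0
  then show ?case by simp
next
  case (Suc n)
  then obtain u where "(r, u) \<in> E ^^ n" "(u, v) \<in> E" by auto
  then show ?case using Suc.IH[of u] E_sides[of u v] disjoint_VW by auto
qed

lemma E_imp_is_parent:
  assumes "(u, v) \<in> E"
  shows "is_parent u v \<or> is_parent v u"
proof -
  have uv: "(r, u) \<in> E ^^ depth u" "(r, v) \<in> E ^^ depth v"
    using depth_path E_vertices[OF assms] by blast+
  have "depth v \<le> Suc (depth u)" "depth u \<le> Suc (depth v)"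
    using relpow_Suc_I[OF uv(1) assms] relpow_Suc_I[OF uv(2) E_sym[OF assms]] depth_le by blast+
  moreover have "depth u \<noteq> depth v"
    using parity[OF uv(1)] parity[OF uv(2)] E_sides[OF assms] disjoint_VW by auto
  ultimately have "depth v = Suc (depth u) \<or> depth u = Suc (depth v)" by linarith
  then show ?thesis using assms E_sym[OF assms] unfolding is_parent_def by blast
qed

lemma parent_exists:
  assumes "v \<in> vertices G" and "depth v = Suc n"
  obtains u where "is_parent u v" "depth u = n"
proof -
  obtain u where u: "(r, u) \<in> E ^^ n" "(u, v) \<in> E"
    using depth_path[OF assms(1)] assms(2) by auto
  have "depth u \<le> n" using u depth_le by blast
  moreover have "is_parent u v"
    using E_imp_is_parent[OF u(2)] assms(2) calculation unfolding is_parent_def by auto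
  ultimately show thesis using that assms(2) unfolding is_parent_def by auto
qed

lemma root_path:
  assumes "v \<in> vertices G" and "depth v \<le> n"
  shows "(r, v) \<in> (E \<inter> {x. depth x \<le> n} \<times> {x. depth x \<le> n})\<^sup>*"
  using assms
proof (induction "depth v" arbitrary: v)
  case 0
  then show ?case using depth_path[of v] by auto
next
  case (Suc k)
  then obtain u where u: "is_parent u v" "depth u = k" using parent_exists by metis
  then have uv: "(u, v) \<in> E" "u \<in> vertices G" using E_vertices unfolding is_parent_def by blast+
  have "depth u \<le> n" using u Suc by simp
  then have "(r, u) \<in> (E \<inter> {x. depth x \<le> n} \<times> {x. depth x \<le> n})\<^sup>*"
    using Suc.hyps(1)[of u] u uv by blast
  then show ?case
    using uv \<open>depth u \<le> n\<close> Suc.prems by (auto intro: rtrancl_into_rtrancl)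
qed

text \<open>Two parents would be joined via the root by a path among vertices no deeper than
  themselves; \<open>v\<close> lies deeper, so it would close this path to a cycle.\<close>

lemma is_parent_unique:
  assumes "is_parent a v" and "is_parent b v"
  shows "a = b"
proof (rule ccontr)
  assume "a \<noteq> b"
  define S where "S = {x \<in> vertices G. depth x \<le> depth a}"
  let ?R = "E \<inter> S \<times> S"
  have ab: "(a, v) \<in> E" "(b, v) \<in> E" "depth b = depth a" "depth v = Suc (depth a)"
    using assms unfolding is_parent_def by auto
  then have vert: "a \<in> vertices G" "b \<in> vertices G" "v \<in> vertices G"
    using E_vertices by blast+
  have R: "?R = E \<inter> {x. depth x \<le> depth a} \<times> {x. depth x \<le> depth a}"
    using E_vertices unfolding S_def by blast
  have "(r, a) \<in> ?R\<^sup>*" "(r, b) \<in> ?R\<^sup>*"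
    using root_path vert ab unfolding R by auto
  moreover have "sym ?R" using E_sym by (auto intro: symI)
  ultimately have "(a, b) \<in> ?R\<^sup>*" by (meson rtrancl_trans sym_rtrancl symD)
  moreover have "a \<in> S" using vert unfolding S_def by simp
  ultimately obtain p where p: "p \<noteq> []" "hd p = a" "last p = b" "distinct p" "set p \<subseteq> S"
    "successively (\<lambda>u v. (u, v) \<in> ?R) p"
    using rtrancl_imp_distinct_path[of a b ?R S] by blast
  have suc: "successively (\<lambda>u v. (u, v) \<in> E) p"
    using p(6) by (rule successively_mono) auto
  have "v \<notin> set p" using p(5) ab unfolding S_def by auto
  \<comment> \<open>Together with \<open>v\<close> this reaches the length three required of a
    cycle.\<close>
  moreover have "length p \<ge> 2"
    using p(1-3) \<open>a \<noteq> b\<close> by (cases p rule: remdups_adj.cases) auto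
  ultimately have "cycle G (p @ [v])"
    using p suc ab vert E_sym[OF ab(1)] unfolding cycle_def walk_def S_def E_def
    by (auto simp: successively_append_iff)
  then show False using tree unfolding tree_def by blast
qed

sublocale rooted_forest is_parent
proof
  show "wf {(p, x). is_parent p x}"
    by (rule wf_subset[OF wf_measure[of depth]]) (auto simp: is_parent_def)
  show "is_parent p x \<Longrightarrow> is_parent q x \<Longrightarrow> p = q" for p q x
    by (rule is_parent_unique)
qed

lemma adj_eq: "adj = (\<lambda>u v. {u, v} \<in> edges G)"
proof (intro ext iffI)
  fix u v assume "adj u v"
  then have "(u, v) \<in> E" using E_sym unfolding adj_def is_parent_def by blast
  then show "{u, v} \<in> edges G" unfolding E_def by simp
next
  fix u v assume "{u, v} \<in> edges G"
  then show "adj u v" using E_imp_is_parent[of u v] unfolding adj_def E_def by simp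
qed

end

section \<open>Verification of the matroid axioms\<close>

theorem theorem3p4:
  fixes G :: "'v sgraph" and V W :: "'v set"
  assumes "tree G" and "bipartition G V W"
  shows "is_matroid (M_T G V)"
proof -
  obtain r where "r \<in> vertices G"
    using assms(1) unfolding tree_def connected_graph_def by blast
  then interpret rooted_tree G V W r using assms by unfold_locales
  define \<I> where "\<I> = {I. I \<subseteq> V \<and> inj_matchable adj I}"
  have M_T: "M_T G V = (V, \<I>)"
    unfolding M_T_def \<I>_def adj_eq using matchable_iff_inj_matchable[OF assms(2)] by blast
  have down: "I \<in> \<I>" if "I \<subseteq> J" "J \<in> \<I>" for I J
    using that inj_matchable_subset unfolding \<I>_def by blast
  have empty: "{} \<in> \<I>" unfolding \<I>_def inj_matchable_def by simp
  have exchange: "\<exists>x\<in>I' - I. I \<union> {x} \<in> \<I>"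
    if I: "I \<in> \<I> - max_members \<I>" and I': "I' \<in> max_members \<I>" for I I'
  proof -
    obtain J where J: "J \<in> \<I>" "I \<subseteq> J" "J \<noteq> I" using I unfolding max_members_def by blast
    then obtain y where y: "y \<in> J" "y \<notin> I" by blast
    have yI: "insert y I \<in> \<I>" by (rule down[OF _ J(1)]) (use J y in blast)
    have "insert y I' \<notin> \<I>" if "y \<notin> I'"
      using I' that unfolding max_members_def by blast
    then have "\<exists>x\<in>I' - I. inj_matchable adj (insert x I)"
      using inj_matchable_exchange[of adj y I I'] yI y I' unfolding \<I>_def max_members_def by blast
    then show ?thesis using I I' unfolding \<I>_def max_members_def by auto
  qed
  have maximal: "max_members {I' \<in> \<I>. I \<subseteq> I' \<and> I' \<subseteq> X} \<noteq> {}"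
    if I: "I \<in> \<I>" "I \<subseteq> X" "X \<subseteq> V" for I X
  proof -
    obtain B where B: "I \<subseteq> B" "B \<subseteq> X" "inj_matchable adj B"
      "\<And>x. x \<in> X - B \<Longrightarrow> \<not> inj_matchable adj (insert x B)"
      using maximal_inj_matchable[of I X] I unfolding \<I>_def by blast
    \<comment> \<open>Matchability passes to subsets, so excluding one-point extensions of
      \<open>B\<close> excludes all larger sets.\<close>
    have "C = B" if C: "C \<in> \<I>" "C \<subseteq> X" "B \<subseteq> C" for C
    proof (rule ccontr)
      assume "C \<noteq> B"
      then obtain x where "x \<in> C" "x \<notin> B" using C by blast
      then show False
        using B(4)[of x] C inj_matchable_subset[of adj C "insert x B"] unfolding \<I>_def by blast
    qed
    then have "B \<in> max_members {I' \<in> \<I>. I \<subseteq> I' \<and> I' \<subseteq> X}"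
      using B(1-3) I(3) unfolding max_members_def \<I>_def by blast
    then show ?thesis by blast
  qed
  show ?thesis
    unfolding M_T using down empty exchange maximal by (auto simp: \<I>_def)
qed

end
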